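(* Let $\gamma_P:\mathbb{R}^n\to\mathbb{R}$ be continuous and concave, let $\rho_P:\mathbb{R}^n\to\mathbb{R}$ be continuous and convex, let $(\rho_P^{\text{ref}},\gamma_P^{\text{ref}})\in\mathbb{R}^2$ be a reference point, and let $X$ and $A$ be as defined in the context. Let $x_A$ be an efficient portfolio in the sense of the context, that is, a global solution of the problem of maximizing $A(x)$ over $x\in X$. Then: (a) if a feasible portfolio $x\in X$ is such that $\gamma_P(x)-\gamma_P^{\text{ref}}=\alpha\big(\gamma_P(x_A)-\gamma_P^{\text{ref}}\big)$ for some $\alpha\ge 1$, then $\alpha\big(\rho_P^{\text{ref}}-\rho_P(x)\big)\le\rho_P^{\text{ref}}-\rho_P(x_A)$; (b) if a feasible portfolio $x\in X$ is such that $\rho_P^{\text{ref}}-\rho_P(x)=\beta\big(\rho_P^{\text{ref}}-\rho_P(x_A)\big)$ for some $\beta\ge 1$, then $\beta\big(\gamma_P(x)-\gamma_P^{\text{ref}}\big)\le\gamma_P(x_A)-\gamma_P^{\text{ref}}$.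
   Context: $\Delta=\{x\in\mathbb{R}^n : x\ge 0,\ \sum_{i=1}^n x_i=1\}$ is the unit simplex (the set of portfolios); $\gamma_P$ is a measure of gain and $\rho_P$ a measure of risk. $X=\{x\in\Delta : \gamma_P(x)\ge\gamma_P^{\text{ref}},\ \rho_P(x)\le\rho_P^{\text{ref}}\}$ and $A(x)=\big(\gamma_P(x)-\gamma_P^{\text{ref}}\big)\big(\rho_P^{\text{ref}}-\rho_P(x)\big)$. A global solution of the maximization problem is a point $x_A\in X$ with $A(x_A)\ge A(x)$ for all $x\in X$. Such a generic global solution is referred to as the (Pareto) efficient portfolio $x_A$ of the two-objective problem of minimizing $(-\gamma_P(x),\rho_P(x))$ over $x\in\Delta$.
   Formalization: Part (a) is stated for γ_P(x_A) ≠ γ_P^ref and part (b) for ρ_P(x_A) ≠ ρ_P^ref; otherwise the scaling factor is undetermined and the claim can fail (e.g. n=1, γ_P=ρ_P=0, γ_P^ref=0, ρ_P^ref=1, x=x_A, α=2). *)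

theory Defs
  imports "HOL-Analysis.Analysis"
begin

definition unit_simplex :: "(real ^ 'n) set" where
  "unit_simplex = {x. (\<forall>i. 0 \<le> x $ i) \<and> (\<Sum>i\<in>UNIV. x $ i) = 1}"

text \<open>In the following definitions \<open>\<gamma>\<close> and \<open>\<rho>\<close> measure gain and risk, and
  \<open>\<gamma>ref\<close>, \<open>\<rho>ref\<close> are the coordinates of the reference point.\<close>

definition feasible_portfolios ::
    "(real ^ 'n \<Rightarrow> real) \<Rightarrow> (real ^ 'n \<Rightarrow> real) \<Rightarrow> real \<Rightarrow> real \<Rightarrow> (real ^ 'n) set" where
  "feasible_portfolios \<gamma> \<rho> \<gamma>ref \<rho>ref = {x \<in> unit_simplex. \<gamma> x \<ge> \<gamma>ref \<and> \<rho> x \<le> \<rho>ref}"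

definition area ::
    "(real ^ 'n \<Rightarrow> real) \<Rightarrow> (real ^ 'n \<Rightarrow> real) \<Rightarrow> real \<Rightarrow> real \<Rightarrow> real ^ 'n \<Rightarrow> real" where
  "area \<gamma> \<rho> \<gamma>ref \<rho>ref x = (\<gamma> x - \<gamma>ref) * (\<rho>ref - \<rho> x)"

text \<open>``Efficient'' means a global maximiser of \<^const>\<open>area\<close> over the feasible set; Pareto
  optimality is not part of the definition.\<close>

definition efficient_portfolio ::
    "(real ^ 'n \<Rightarrow> real) \<Rightarrow> (real ^ 'n \<Rightarrow> real) \<Rightarrow> real \<Rightarrow> real \<Rightarrow> real ^ 'n \<Rightarrow> bool" where
  "efficient_portfolio \<gamma> \<rho> \<gamma>ref \<rho>ref xA \<longleftrightarrow>
     xA \<in> feasible_portfolios \<gamma> \<rho> \<gamma>ref \<rho>ref \<and>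
     (\<forall>x \<in> feasible_portfolios \<gamma> \<rho> \<gamma>ref \<rho>ref. area \<gamma> \<rho> \<gamma>ref \<rho>ref xA \<ge> area \<gamma> \<rho> \<gamma>ref \<rho>ref x)"

text \<open>A maximiser may lie on the boundary \<open>\<gamma> xA = \<gamma>ref\<close> or \<open>\<rho> xA = \<rho>ref\<close> (then \<^const>\<open>area\<close>
  vanishes on the whole feasible set). If \<open>\<gamma> xA = \<gamma>ref\<close>, a relation
  \<open>\<gamma> x - \<gamma>ref = \<alpha> * (\<gamma> xA - \<gamma>ref)\<close> does not determine \<open>\<alpha>\<close>, and a bound on
  \<open>\<alpha> * (\<rho>ref - \<rho> x)\<close> fails in general, for example for \<open>x = xA\<close>, \<open>\<alpha> = 2\<close>,
  \<open>\<rho> xA < \<rho>ref\<close>. The case \<open>\<rho> xA = \<rho>ref\<close> is symmetric. Statements about such multiples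
  \<open>\<alpha>\<close> (or \<open>\<beta>\<close>) therefore require the quantity being multiplied to be nonzero.\<close>

end

theory Submission
  imports Defs
begin

text \<open>Write \<open>a\<close> and \<open>b\<close> for the excess gain and the risk margin of the efficient portfolio.
  Maximality bounds the product of these two quantities for every feasible portfolio by \<open>a * b\<close>.
  If one of them is \<open>\<alpha>\<close> times its value at the maximiser, then cancelling that positive value
  from the product inequality leaves \<open>\<alpha>\<close> times the other one bounded by its value at the
  maximiser. Gain and risk enter symmetrically, so a single cancellation serves both parts.\<close>

lemma area_le_efficient:
  assumes "efficient_portfolio \<gamma> \<rho> \<gamma>ref \<rho>ref xA" and "x \<in> feasible_portfolios \<gamma> \<rho> \<gamma>ref \<rho>ref"
  shows "(\<gamma> x - \<gamma>ref) * (\<rho>ref - \<rho> x) \<le> (\<gamma> xA - \<gamma>ref) * (\<rho>ref - \<rho> xA)"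
  using assms unfolding efficient_portfolio_def area_def by blast

lemma scaled_factor_le_of_product_le:
  fixes a b c y :: real
  assumes "0 < a" and "(c * a) * y \<le> a * b"
  shows "c * y \<le> b"
proof -
  have "a * (c * y) \<le> a * b"
    using assms(2) by (simp add: mult.assoc mult.left_commute)
  then show ?thesis
    using assms(1) by simp
qed

theorem proposition2p4:
  fixes \<gamma> \<rho> :: "real ^ 'n \<Rightarrow> real"
    and \<gamma>ref \<rho>ref :: real
    and xA :: "real ^ 'n"
  assumes "continuous_on UNIV \<gamma>" and "concave_on UNIV \<gamma>"
    and "continuous_on UNIV \<rho>" and "convex_on UNIV \<rho>"
    and "efficient_portfolio \<gamma> \<rho> \<gamma>ref \<rho>ref xA"
  shows "(\<gamma> xA \<noteq> \<gamma>ref \<longrightarrow>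
            (\<forall>x \<in> feasible_portfolios \<gamma> \<rho> \<gamma>ref \<rho>ref. \<forall>\<alpha>\<ge>1.
               \<gamma> x - \<gamma>ref = \<alpha> * (\<gamma> xA - \<gamma>ref) \<longrightarrow>
               \<alpha> * (\<rho>ref - \<rho> x) \<le> \<rho>ref - \<rho> xA))
       \<and> (\<rho> xA \<noteq> \<rho>ref \<longrightarrow>
            (\<forall>x \<in> feasible_portfolios \<gamma> \<rho> \<gamma>ref \<rho>ref. \<forall>\<beta>\<ge>1.
               \<rho>ref - \<rho> x = \<beta> * (\<rho>ref - \<rho> xA) \<longrightarrow>
               \<beta> * (\<gamma> x - \<gamma>ref) \<le> \<gamma> xA - \<gamma>ref))"
proof -
  have feasible: "\<gamma>ref \<le> \<gamma> xA" "\<rho> xA \<le> \<rho>ref"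
    using assms(5) by (auto simp: efficient_portfolio_def feasible_portfolios_def)
  show ?thesis
  proof (intro conjI impI ballI allI)
    fix x \<alpha>
    assume "\<gamma> xA \<noteq> \<gamma>ref" and x: "x \<in> feasible_portfolios \<gamma> \<rho> \<gamma>ref \<rho>ref"
      and gain: "\<gamma> x - \<gamma>ref = \<alpha> * (\<gamma> xA - \<gamma>ref)"
    then have "0 < \<gamma> xA - \<gamma>ref"
      using feasible by simp
    moreover have "(\<alpha> * (\<gamma> xA - \<gamma>ref)) * (\<rho>ref - \<rho> x) \<le> (\<gamma> xA - \<gamma>ref) * (\<rho>ref - \<rho> xA)"
      using area_le_efficient[OF assms(5) x] unfolding gain .
    ultimately show "\<alpha> * (\<rho>ref - \<rho> x) \<le> \<rho>ref - \<rho> xA"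
      by (rule scaled_factor_le_of_product_le)
  next
    fix x \<beta>
    assume "\<rho> xA \<noteq> \<rho>ref" and x: "x \<in> feasible_portfolios \<gamma> \<rho> \<gamma>ref \<rho>ref"
      and risk: "\<rho>ref - \<rho> x = \<beta> * (\<rho>ref - \<rho> xA)"
    then have "0 < \<rho>ref - \<rho> xA"
      using feasible by simp
    moreover have "(\<beta> * (\<rho>ref - \<rho> xA)) * (\<gamma> x - \<gamma>ref) \<le> (\<rho>ref - \<rho> xA) * (\<gamma> xA - \<gamma>ref)"
      using area_le_efficient[OF assms(5) x] unfolding risk by (simp only: mult.commute)
    ultimately show "\<beta> * (\<gamma> x - \<gamma>ref) \<le> \<gamma> xA - \<gamma>ref"
      by (rule scaled_factor_le_of_product_le)
  qed
qed

end
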